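(* Let $(M,J,g)$ be a Vaisman manifold, and let $c$ be the torsion $3$-form of its Bismut connection $\nabla^b$. Then $c$ is $\nabla^b$-parallel, i.e. $\nabla^b c=0$.
   Context: Let $(M,J,g)$ be a Hermitian manifold (real dimension $2n\ge 4$) with fundamental $2$-form $\omega(X,Y)=g(JX,Y)$ and Levi-Civita connection $\nabla^g$. It is locally conformally Kähler (LCK) if there is a closed $1$-form $\theta$ (the Lee form) with $d\omega=\theta\wedge\omega$; it is Vaisman if moreover $\nabla^g\theta=0$. The Bismut connection $\nabla^b$ is the unique connection with $\nabla^b g=0$, $\nabla^b J=0$ and totally skew-symmetric torsion $T^b$; explicitly $g(\nabla^b_XY,Z)=g(\nabla^g_XY,Z)+\tfrac12 d\omega(JX,JY,JZ)$. Its torsion $3$-form is $c(X,Y,Z)=g(X,T^b(Y,Z))=d\omega(JX,JY,JZ)$. *)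

theory Defs
  imports "HOL-Analysis.Analysis"
begin

section \<open>Smooth manifolds and smooth functions\<close>

(* On an open set S, C_k 0 is continuity, and C_k (Suc k) asks for differentiability
   together with C_k-dependence of every directional derivative on the base point.
   Only meaningful for open S. *)
fun C_k_on :: "nat \<Rightarrow> 'e::euclidean_space set \<Rightarrow> ('e \<Rightarrow> 'f::real_normed_vector) \<Rightarrow> bool" where
  "C_k_on 0 S f = continuous_on S f"
| "C_k_on (Suc k) S f =
     ((\<forall>x\<in>S. f differentiable (at x)) \<and>
      (\<forall>v. C_k_on k S (\<lambda>x. frechet_derivative f (at x) v)))"

definition smooth_on :: "'e::euclidean_space set \<Rightarrow> ('e \<Rightarrow> 'f::real_normed_vector) \<Rightarrow> bool" where
  "smooth_on S f \<longleftrightarrow> (\<forall>k. C_k_on k S f)"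

(* A chart is a pair (U, \<phi>) of its domain and coordinate map; \<phi> is irrelevant outside U.
   The atlas need not be maximal. The manifold has dimension DIM('e). *)
record ('a, 'e) manifold =
  space_of :: "'a topology"
  atlas :: "('a set \<times> ('a \<Rightarrow> 'e)) set"

definition pts :: "('a, 'e) manifold \<Rightarrow> 'a set" where
  "pts M = topspace (space_of M)"

definition smooth_manifold :: "('a, 'e::euclidean_space) manifold \<Rightarrow> bool" where
  "smooth_manifold M \<longleftrightarrow>
     Hausdorff_space (space_of M) \<and> second_countable (space_of M) \<and>
     pts M = (\<Union>(U, \<phi>)\<in>atlas M. U) \<and>
     (\<forall>(U, \<phi>)\<in>atlas M. openin (space_of M) U \<and> open (\<phi> ` U) \<and>
        homeomorphic_map (subtopology (space_of M) U) (top_of_set (\<phi> ` U)) \<phi>) \<and>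
     (\<forall>(U, \<phi>)\<in>atlas M. \<forall>(V, \<psi>)\<in>atlas M.
        smooth_on (\<phi> ` (U \<inter> V)) (\<psi> \<circ> inv_into U \<phi>))"

(* Functions on M are represented by functions on the ambient type that vanish off M,
   so that equality of functions on M is HOL equality. The same convention is used for
   vector fields and tensor fields below. *)
definition smooth_functions :: "('a, 'e::euclidean_space) manifold \<Rightarrow> ('a \<Rightarrow> real) set" where
  "smooth_functions M = {f. (\<forall>p. p \<notin> pts M \<longrightarrow> f p = 0) \<and>
     (\<forall>(U, \<phi>)\<in>atlas M. smooth_on (\<phi> ` U) (f \<circ> inv_into U \<phi>))}"

section \<open>Tangent vectors and vector fields\<close>

type_synonym 'a tangent = "('a \<Rightarrow> real) \<Rightarrow> real"
type_synonym 'a vfield = "'a \<Rightarrow> 'a tangent"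

(* Derivations at p of the algebra of smooth functions on M, extended by 0 to
   functions that are not smooth. *)
definition tangent_space :: "('a, 'e::euclidean_space) manifold \<Rightarrow> 'a \<Rightarrow> 'a tangent set" where
  "tangent_space M p = {v.
     (\<forall>f. f \<notin> smooth_functions M \<longrightarrow> v f = 0) \<and>
     (\<forall>f\<in>smooth_functions M. \<forall>h\<in>smooth_functions M.
        (\<forall>a. v (\<lambda>q. a * f q + h q) = a * v f + v h) \<and>
        v (\<lambda>q. f q * h q) = f p * v h + v f * h p)}"

definition zero_tangent :: "'a tangent" where
  "zero_tangent = (\<lambda>f. 0)"

definition tangent_add :: "'a tangent \<Rightarrow> 'a tangent \<Rightarrow> 'a tangent" where
  "tangent_add u v = (\<lambda>f. u f + v f)"

definition tangent_scale :: "real \<Rightarrow> 'a tangent \<Rightarrow> 'a tangent" where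
  "tangent_scale a u = (\<lambda>f. a * u f)"

definition act :: "'a vfield \<Rightarrow> ('a \<Rightarrow> real) \<Rightarrow> 'a \<Rightarrow> real" where
  "act X f = (\<lambda>p. X p f)"

definition vector_fields :: "('a, 'e::euclidean_space) manifold \<Rightarrow> 'a vfield set" where
  "vector_fields M = {X.
     (\<forall>p\<in>pts M. X p \<in> tangent_space M p) \<and>
     (\<forall>p. p \<notin> pts M \<longrightarrow> X p = zero_tangent) \<and>
     (\<forall>f\<in>smooth_functions M. act X f \<in> smooth_functions M)}"

definition vf_add :: "'a vfield \<Rightarrow> 'a vfield \<Rightarrow> 'a vfield" where
  "vf_add X Y = (\<lambda>p. tangent_add (X p) (Y p))"

definition vf_diff :: "'a vfield \<Rightarrow> 'a vfield \<Rightarrow> 'a vfield" where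
  "vf_diff X Y = (\<lambda>p. tangent_add (X p) (tangent_scale (-1) (Y p)))"

definition vf_scale :: "('a \<Rightarrow> real) \<Rightarrow> 'a vfield \<Rightarrow> 'a vfield" where
  "vf_scale a X = (\<lambda>p. tangent_scale (a p) (X p))"

definition lie_bracket :: "'a vfield \<Rightarrow> 'a vfield \<Rightarrow> 'a vfield" where
  "lie_bracket X Y = (\<lambda>p f. X p (act Y f) - Y p (act X f))"

section \<open>Tensor fields\<close>

type_synonym 'a form1 = "'a \<Rightarrow> 'a tangent \<Rightarrow> real"
type_synonym 'a form2 = "'a \<Rightarrow> 'a tangent \<Rightarrow> 'a tangent \<Rightarrow> real"
type_synonym 'a endo = "'a \<Rightarrow> 'a tangent \<Rightarrow> 'a tangent"

definition ev1 :: "'a form1 \<Rightarrow> 'a vfield \<Rightarrow> 'a \<Rightarrow> real" where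
  "ev1 \<theta> X = (\<lambda>p. \<theta> p (X p))"

definition ev2 :: "'a form2 \<Rightarrow> 'a vfield \<Rightarrow> 'a vfield \<Rightarrow> 'a \<Rightarrow> real" where
  "ev2 b X Y = (\<lambda>p. b p (X p) (Y p))"

definition app :: "'a endo \<Rightarrow> 'a vfield \<Rightarrow> 'a vfield" where
  "app J X = (\<lambda>p. J p (X p))"

definition one_form :: "('a, 'e::euclidean_space) manifold \<Rightarrow> 'a form1 \<Rightarrow> bool" where
  "one_form M \<theta> \<longleftrightarrow>
     (\<forall>p\<in>pts M. \<forall>u\<in>tangent_space M p. \<forall>v\<in>tangent_space M p. \<forall>a.
        \<theta> p (tangent_add (tangent_scale a u) v) = a * \<theta> p u + \<theta> p v) \<and>
     (\<forall>p u. p \<notin> pts M \<longrightarrow> \<theta> p u = 0) \<and>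
     (\<forall>X\<in>vector_fields M. ev1 \<theta> X \<in> smooth_functions M)"

definition riemannian_metric :: "('a, 'e::euclidean_space) manifold \<Rightarrow> 'a form2 \<Rightarrow> bool" where
  "riemannian_metric M g \<longleftrightarrow>
     (\<forall>p\<in>pts M. \<forall>u\<in>tangent_space M p. \<forall>v\<in>tangent_space M p.
        (\<forall>w\<in>tangent_space M p. \<forall>a.
           g p (tangent_add (tangent_scale a u) v) w = a * g p u w + g p v w) \<and>
        g p u v = g p v u \<and>
        (u \<noteq> zero_tangent \<longrightarrow> g p u u > 0)) \<and>
     (\<forall>p u v. p \<notin> pts M \<longrightarrow> g p u v = 0) \<and>
     (\<forall>X\<in>vector_fields M. \<forall>Y\<in>vector_fields M. ev2 g X Y \<in> smooth_functions M)"

definition almost_complex_structure ::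
    "('a, 'e::euclidean_space) manifold \<Rightarrow> 'a endo \<Rightarrow> bool" where
  "almost_complex_structure M J \<longleftrightarrow>
     (\<forall>p\<in>pts M. \<forall>u\<in>tangent_space M p.
        J p u \<in> tangent_space M p \<and>
        J p (J p u) = tangent_scale (-1) u \<and>
        (\<forall>v\<in>tangent_space M p. \<forall>a.
           J p (tangent_add (tangent_scale a u) v) =
             tangent_add (tangent_scale a (J p u)) (J p v))) \<and>
     (\<forall>p u. p \<notin> pts M \<longrightarrow> J p u = zero_tangent) \<and>
     (\<forall>X\<in>vector_fields M. app J X \<in> vector_fields M)"

definition nijenhuis :: "'a endo \<Rightarrow> 'a vfield \<Rightarrow> 'a vfield \<Rightarrow> 'a vfield" where
  "nijenhuis J X Y =
     vf_diff (vf_diff (lie_bracket (app J X) (app J Y)) (lie_bracket X Y))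
       (app J (vf_add (lie_bracket (app J X) Y) (lie_bracket X (app J Y))))"

definition integrable_acs :: "('a, 'e::euclidean_space) manifold \<Rightarrow> 'a endo \<Rightarrow> bool" where
  "integrable_acs M J \<longleftrightarrow>
     (\<forall>X\<in>vector_fields M. \<forall>Y\<in>vector_fields M. nijenhuis J X Y = (\<lambda>p. zero_tangent))"

section \<open>Exterior calculus\<close>

(* Normalised without factors 1/(k+1), so that the wedge product of a 1-form and a
   2-form is the cyclic sum. Forms of degree 2 and 3 obtained by differentiation are
   represented by their values on vector fields. *)
definition ext_deriv1 :: "'a form1 \<Rightarrow> 'a vfield \<Rightarrow> 'a vfield \<Rightarrow> 'a \<Rightarrow> real" where
  "ext_deriv1 \<theta> X Y = (\<lambda>p.
     act X (ev1 \<theta> Y) p - act Y (ev1 \<theta> X) p - ev1 \<theta> (lie_bracket X Y) p)"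

definition ext_deriv2 ::
    "'a form2 \<Rightarrow> 'a vfield \<Rightarrow> 'a vfield \<Rightarrow> 'a vfield \<Rightarrow> 'a \<Rightarrow> real" where
  "ext_deriv2 b X Y Z = (\<lambda>p.
     act X (ev2 b Y Z) p - act Y (ev2 b X Z) p + act Z (ev2 b X Y) p
     - ev2 b (lie_bracket X Y) Z p + ev2 b (lie_bracket X Z) Y p - ev2 b (lie_bracket Y Z) X p)"

definition wedge12 ::
    "'a form1 \<Rightarrow> 'a form2 \<Rightarrow> 'a vfield \<Rightarrow> 'a vfield \<Rightarrow> 'a vfield \<Rightarrow> 'a \<Rightarrow> real" where
  "wedge12 \<theta> b X Y Z = (\<lambda>p.
     ev1 \<theta> X p * ev2 b Y Z p + ev1 \<theta> Y p * ev2 b Z X p + ev1 \<theta> Z p * ev2 b X Y p)"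

section \<open>Connections\<close>

type_synonym 'a connection = "'a vfield \<Rightarrow> 'a vfield \<Rightarrow> 'a vfield"

definition affine_connection ::
    "('a, 'e::euclidean_space) manifold \<Rightarrow> 'a connection \<Rightarrow> bool" where
  "affine_connection M D \<longleftrightarrow>
     (\<forall>X\<in>vector_fields M. \<forall>Y\<in>vector_fields M.
        D X Y \<in> vector_fields M \<and>
        (\<forall>Z\<in>vector_fields M.
           D (vf_add X Y) Z = vf_add (D X Z) (D Y Z) \<and>
           D X (vf_add Y Z) = vf_add (D X Y) (D X Z)) \<and>
        (\<forall>f\<in>smooth_functions M.
           D (vf_scale f X) Y = vf_scale f (D X Y) \<and>
           D X (vf_scale f Y) = vf_add (vf_scale (act X f) Y) (vf_scale f (D X Y))))"

definition torsion :: "'a connection \<Rightarrow> 'a vfield \<Rightarrow> 'a vfield \<Rightarrow> 'a vfield" where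
  "torsion D X Y = vf_diff (vf_diff (D X Y) (D Y X)) (lie_bracket X Y)"

definition cov_deriv1 :: "'a connection \<Rightarrow> 'a form1 \<Rightarrow> 'a vfield \<Rightarrow> 'a vfield \<Rightarrow> 'a \<Rightarrow> real" where
  "cov_deriv1 D \<theta> W X = (\<lambda>p. act W (ev1 \<theta> X) p - ev1 \<theta> (D W X) p)"

definition cov_deriv2 ::
    "'a connection \<Rightarrow> 'a form2 \<Rightarrow> 'a vfield \<Rightarrow> 'a vfield \<Rightarrow> 'a vfield \<Rightarrow> 'a \<Rightarrow> real" where
  "cov_deriv2 D b W X Y = (\<lambda>p.
     act W (ev2 b X Y) p - ev2 b (D W X) Y p - ev2 b X (D W Y) p)"

definition cov_deriv_endo :: "'a connection \<Rightarrow> 'a endo \<Rightarrow> 'a vfield \<Rightarrow> 'a vfield \<Rightarrow> 'a vfield" where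
  "cov_deriv_endo D J W X = vf_diff (D W (app J X)) (app J (D W X))"

definition cov_deriv3 ::
    "'a connection \<Rightarrow> ('a vfield \<Rightarrow> 'a vfield \<Rightarrow> 'a vfield \<Rightarrow> 'a \<Rightarrow> real) \<Rightarrow>
     'a vfield \<Rightarrow> 'a vfield \<Rightarrow> 'a vfield \<Rightarrow> 'a vfield \<Rightarrow> 'a \<Rightarrow> real" where
  "cov_deriv3 D c W X Y Z = (\<lambda>p.
     act W (c X Y Z) p - c (D W X) Y Z p - c X (D W Y) Z p - c X Y (D W Z) p)"

definition parallel1 ::
    "('a, 'e::euclidean_space) manifold \<Rightarrow> 'a connection \<Rightarrow> 'a form1 \<Rightarrow> bool" where
  "parallel1 M D \<theta> \<longleftrightarrow>
     (\<forall>W\<in>vector_fields M. \<forall>X\<in>vector_fields M. cov_deriv1 D \<theta> W X = (\<lambda>p. 0))"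

definition parallel2 ::
    "('a, 'e::euclidean_space) manifold \<Rightarrow> 'a connection \<Rightarrow> 'a form2 \<Rightarrow> bool" where
  "parallel2 M D b \<longleftrightarrow>
     (\<forall>W\<in>vector_fields M. \<forall>X\<in>vector_fields M. \<forall>Y\<in>vector_fields M.
        cov_deriv2 D b W X Y = (\<lambda>p. 0))"

definition parallel_endo ::
    "('a, 'e::euclidean_space) manifold \<Rightarrow> 'a connection \<Rightarrow> 'a endo \<Rightarrow> bool" where
  "parallel_endo M D J \<longleftrightarrow>
     (\<forall>W\<in>vector_fields M. \<forall>X\<in>vector_fields M. cov_deriv_endo D J W X = (\<lambda>p. zero_tangent))"

definition parallel3 ::
    "('a, 'e::euclidean_space) manifold \<Rightarrow> 'a connection \<Rightarrow>
     ('a vfield \<Rightarrow> 'a vfield \<Rightarrow> 'a vfield \<Rightarrow> 'a \<Rightarrow> real) \<Rightarrow> bool" where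
  "parallel3 M D c \<longleftrightarrow>
     (\<forall>W\<in>vector_fields M. \<forall>X\<in>vector_fields M. \<forall>Y\<in>vector_fields M. \<forall>Z\<in>vector_fields M.
        cov_deriv3 D c W X Y Z = (\<lambda>p. 0))"

definition levi_civita ::
    "('a, 'e::euclidean_space) manifold \<Rightarrow> 'a form2 \<Rightarrow> 'a connection \<Rightarrow> bool" where
  "levi_civita M g D \<longleftrightarrow>
     affine_connection M D \<and> parallel2 M D g \<and>
     (\<forall>X\<in>vector_fields M. \<forall>Y\<in>vector_fields M. torsion D X Y = (\<lambda>p. zero_tangent))"

section \<open>Hermitian and Vaisman manifolds, the Bismut connection\<close>

definition hermitian_manifold ::
    "('a, 'e::euclidean_space) manifold \<Rightarrow> 'a endo \<Rightarrow> 'a form2 \<Rightarrow> bool" where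
  "hermitian_manifold M J g \<longleftrightarrow>
     smooth_manifold M \<and> riemannian_metric M g \<and>
     almost_complex_structure M J \<and> integrable_acs M J \<and>
     (\<forall>p\<in>pts M. \<forall>u\<in>tangent_space M p. \<forall>v\<in>tangent_space M p. g p (J p u) (J p v) = g p u v)"

definition fundamental_form :: "'a endo \<Rightarrow> 'a form2 \<Rightarrow> 'a form2" where
  "fundamental_form J g = (\<lambda>p u v. g p (J p u) v)"

definition lee_form ::
    "('a, 'e::euclidean_space) manifold \<Rightarrow> 'a endo \<Rightarrow> 'a form2 \<Rightarrow> 'a form1 \<Rightarrow> bool" where
  "lee_form M J g \<theta> \<longleftrightarrow> one_form M \<theta> \<and>
     (\<forall>X\<in>vector_fields M. \<forall>Y\<in>vector_fields M. ext_deriv1 \<theta> X Y = (\<lambda>p. 0)) \<and>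
     (\<forall>X\<in>vector_fields M. \<forall>Y\<in>vector_fields M. \<forall>Z\<in>vector_fields M.
        ext_deriv2 (fundamental_form J g) X Y Z = wedge12 \<theta> (fundamental_form J g) X Y Z)"

(* The Levi-Civita connection exists and is unique on vector fields, so quantifying D
   existentially just names it. *)
definition vaisman_manifold ::
    "('a, 'e::euclidean_space) manifold \<Rightarrow> 'a endo \<Rightarrow> 'a form2 \<Rightarrow> bool" where
  "vaisman_manifold M J g \<longleftrightarrow> hermitian_manifold M J g \<and>
     (\<exists>\<theta> D. lee_form M J g \<theta> \<and> levi_civita M g D \<and> parallel1 M D \<theta>)"

definition torsion_form ::
    "'a form2 \<Rightarrow> 'a connection \<Rightarrow> 'a vfield \<Rightarrow> 'a vfield \<Rightarrow> 'a vfield \<Rightarrow> 'a \<Rightarrow> real" where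
  "torsion_form g D X Y Z = ev2 g X (torsion D Y Z)"

(* Skew-symmetry in the last two arguments of the torsion form is automatic. *)
definition bismut_connection ::
    "('a, 'e::euclidean_space) manifold \<Rightarrow> 'a endo \<Rightarrow> 'a form2 \<Rightarrow> 'a connection \<Rightarrow> bool" where
  "bismut_connection M J g D \<longleftrightarrow>
     affine_connection M D \<and> parallel2 M D g \<and> parallel_endo M D J \<and>
     (\<forall>X\<in>vector_fields M. \<forall>Y\<in>vector_fields M. \<forall>Z\<in>vector_fields M. \<forall>p.
        torsion_form g D X Y Z p = - torsion_form g D Y X Z p \<and>
        torsion_form g D X Y Z p = - torsion_form g D X Z Y p)"

end

theory Submission
  imports Defs
begin

text \<open>Write \<open>\<alpha> = \<theta> \<circ> J\<close>. Since the Bismut connection preserves \<open>\<omega>\<close>, \<open>d\<omega>\<close> is an algebraic expression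
  in its torsion, and the vanishing of the Nijenhuis tensor turns this into
  \<open>c(X,Y,Z) = d\<omega>(JX,JY,JZ)\<close>; with \<open>d\<omega> = \<theta> \<and> \<omega>\<close> this is \<open>c = \<alpha> \<and> \<omega>\<close>. As \<open>\<omega>\<close> and \<open>J\<close> are
  \<open>\<nabla>\<^sup>b\<close>-parallel, it remains to see that \<open>\<theta>\<close> is. Since \<open>\<nabla>\<^sup>g\<theta> = 0\<close>, this means that \<open>\<theta>\<close> kills
  \<open>\<nabla>\<^sup>b\<^sub>W X - \<nabla>\<^sup>g\<^sub>W X\<close>, the vector field dual to \<open>c(W,X,-)/2\<close>. The field
  \<open>V = 2(\<nabla>\<^sup>b\<^sub>W X - \<nabla>\<^sup>g\<^sub>W X) + \<alpha>(X)JW - \<alpha>(W)JX\<close> has the same value under \<open>\<theta>\<close> and satisfies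
  \<open>g(V,Z) = \<omega>(W,X) \<alpha>(Z)\<close>; taking \<open>Z = JV\<close> and \<open>Z = V\<close> gives \<open>\<theta>(V) = 0\<close> without
  constructing the metric dual of \<open>\<theta>\<close>.\<close>

section \<open>Smooth functions form an algebra\<close>

text \<open>On an open set a derivative depends only on values inside the set. This lets a formula
  valid on \<open>S\<close> replace the derivative in the inductions below.\<close>

lemma C_k_on_cong:
  assumes "open S" "\<And>x. x \<in> S \<Longrightarrow> f x = g x"
  shows "C_k_on k S f \<longleftrightarrow> C_k_on k S g"
  using assms(2)
proof (induction k arbitrary: f g)
  case 0
  then show ?case by (auto cong: continuous_on_cong)
next
  case (Suc k)
  have hd: "(f has_derivative D) (at x) \<longleftrightarrow> (g has_derivative D) (at x)" if "x \<in> S" for x D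
    using has_derivative_transform_within_open[OF _ \<open>open S\<close> that] Suc.prems by metis
  \<comment> \<open>\<open>frechet_derivative\<close> is a choice from the derivatives at
    \<open>x\<close>, so equal sets of derivatives give equal choices.\<close>
  have "frechet_derivative f (at x) = frechet_derivative g (at x)" if "x \<in> S" for x
    using hd[OF that] by (simp add: frechet_derivative_def)
  then have "C_k_on k S (\<lambda>x. frechet_derivative f (at x) v)
      \<longleftrightarrow> C_k_on k S (\<lambda>x. frechet_derivative g (at x) v)" for v
    by (intro Suc.IH) simp
  then show ?case
    using hd by (simp add: differentiable_def)
qed

lemma C_k_on_Suc_imp: "C_k_on (Suc k) S f \<Longrightarrow> C_k_on k S f"
proof (induction k arbitrary: f)
  case 0
  then show ?case
    by (auto intro!: continuous_at_imp_continuous_on differentiable_imp_continuous_within)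
next
  case (Suc k)
  then show ?case by (metis C_k_on.simps(2))
qed

lemma C_k_on_add:
  assumes "open S"
  shows "C_k_on k S f \<Longrightarrow> C_k_on k S g \<Longrightarrow> C_k_on k S (\<lambda>x. f x + g x)"
proof (induction k arbitrary: f g)
  case 0
  then show ?case by (auto intro: continuous_on_add)
next
  case (Suc k)
  have "frechet_derivative (\<lambda>x. f x + g x) (at x) v
      = frechet_derivative f (at x) v + frechet_derivative g (at x) v" if "x \<in> S" for x v
    using Suc.prems that
    by (subst frechet_derivative_at[symmetric, OF has_derivative_add])
      (auto simp: frechet_derivative_works)
  then have "C_k_on k S (\<lambda>x. frechet_derivative (\<lambda>x. f x + g x) (at x) v)" for v
    using Suc.IH Suc.prems by (subst C_k_on_cong[OF assms]) auto
  then show ?case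
    using Suc.prems by auto
qed

text \<open>The product rule leaves one factor undifferentiated in each term;
  \<open>C_k_on_Suc_imp\<close> lowers that factor to class \<open>k\<close> so that the induction
  hypothesis applies.\<close>

lemma C_k_on_mult:
  fixes f g :: "'e::euclidean_space \<Rightarrow> real"
  assumes "open S"
  shows "C_k_on k S f \<Longrightarrow> C_k_on k S g \<Longrightarrow> C_k_on k S (\<lambda>x. f x * g x)"
proof (induction k arbitrary: f g)
  case 0
  then show ?case by (auto intro: continuous_on_mult)
next
  case (Suc k)
  have "frechet_derivative (\<lambda>x. f x * g x) (at x) v
      = f x * frechet_derivative g (at x) v + frechet_derivative f (at x) v * g x"
    if "x \<in> S" for x v
    using Suc.prems that
    by (subst frechet_derivative_at[symmetric, OF has_derivative_mult])
      (auto simp: frechet_derivative_works)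
  moreover have "C_k_on k S (\<lambda>x. f x * frechet_derivative g (at x) v
      + frechet_derivative f (at x) v * g x)" for v
    using Suc.prems C_k_on_Suc_imp[OF Suc.prems(1)] C_k_on_Suc_imp[OF Suc.prems(2)]
    by (intro C_k_on_add[OF assms] Suc.IH) auto
  ultimately have "C_k_on k S (\<lambda>x. frechet_derivative (\<lambda>x. f x * g x) (at x) v)" for v
    by (subst C_k_on_cong[OF assms, where g = "\<lambda>x. f x * frechet_derivative g (at x) v
        + frechet_derivative f (at x) v * g x"]) auto
  then show ?case
    using Suc.prems by auto
qed

lemma C_k_on_const: "C_k_on k S (\<lambda>x. c)"
  by (induction k arbitrary: c) auto

text \<open>Openness of the chart images is built into the right-hand side, where the closure lemmas
  for \<open>C_k_on\<close> find their premise.\<close>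

lemma smooth_functions_iff:
  assumes "smooth_manifold M"
  shows "f \<in> smooth_functions M \<longleftrightarrow> (\<forall>p. p \<notin> pts M \<longrightarrow> f p = 0) \<and>
    (\<forall>c\<in>atlas M. open (snd c ` fst c) \<and>
      (\<forall>k. C_k_on k (snd c ` fst c) (\<lambda>x. f (inv_into (fst c) (snd c) x))))"
proof -
  have "\<forall>(U, \<phi>)\<in>atlas M. open (\<phi> ` U)"
    using assms unfolding smooth_manifold_def by blast
  then show ?thesis
    by (auto simp: smooth_functions_def smooth_on_def o_def case_prod_beta)
qed

lemma smooth_functions_add:
  assumes "smooth_manifold M" "f \<in> smooth_functions M" "h \<in> smooth_functions M"
  shows "(\<lambda>p. f p + h p) \<in> smooth_functions M"
  using assms(2,3) unfolding smooth_functions_iff[OF assms(1)] by (simp add: C_k_on_add)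

lemma smooth_functions_mult:
  assumes "smooth_manifold M" "f \<in> smooth_functions M" "h \<in> smooth_functions M"
  shows "(\<lambda>p. f p * h p) \<in> smooth_functions M"
  using assms(2,3) unfolding smooth_functions_iff[OF assms(1)] by (simp add: C_k_on_mult)

lemma smooth_functions_cmult:
  assumes "smooth_manifold M" "f \<in> smooth_functions M"
  shows "(\<lambda>p. a * f p) \<in> smooth_functions M"
  using assms(2) unfolding smooth_functions_iff[OF assms(1)]
  by (simp add: C_k_on_mult C_k_on_const)

lemma smooth_functions_diff:
  assumes "smooth_manifold M" "f \<in> smooth_functions M" "h \<in> smooth_functions M"
  shows "(\<lambda>p. f p - h p) \<in> smooth_functions M"
  using smooth_functions_add[OF assms(1,2) smooth_functions_cmult[OF assms(1,3), of "-1"]] by simp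

section \<open>Vector fields form a module\<close>

lemma tangent_space_add:
  "u \<in> tangent_space M p \<Longrightarrow> v \<in> tangent_space M p \<Longrightarrow> tangent_add u v \<in> tangent_space M p"
  by (auto simp: tangent_space_def tangent_add_def algebra_simps)

lemma tangent_space_scale:
  "u \<in> tangent_space M p \<Longrightarrow> tangent_scale a u \<in> tangent_space M p"
  by (auto simp: tangent_space_def tangent_scale_def algebra_simps)

lemma vector_fields_add:
  assumes "smooth_manifold M" "X \<in> vector_fields M" "Y \<in> vector_fields M"
  shows "vf_add X Y \<in> vector_fields M"
proof -
  have "act (vf_add X Y) f = (\<lambda>p. act X f p + act Y f p)" for f
    by (simp add: act_def vf_add_def tangent_add_def)
  then show ?thesis
    using assms smooth_functions_add[OF assms(1)]
    by (auto simp: vector_fields_def vf_add_def tangent_space_add)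
      (simp add: tangent_add_def zero_tangent_def)
qed

lemma vector_fields_diff:
  assumes "smooth_manifold M" "X \<in> vector_fields M" "Y \<in> vector_fields M"
  shows "vf_diff X Y \<in> vector_fields M"
proof -
  have "act (vf_diff X Y) f = (\<lambda>p. act X f p - act Y f p)" for f
    by (simp add: act_def vf_diff_def tangent_add_def tangent_scale_def)
  then have "act (vf_diff X Y) f \<in> smooth_functions M" if "f \<in> smooth_functions M" for f
    using assms that smooth_functions_diff[OF assms(1)] unfolding vector_fields_def by simp
  then show ?thesis
    using assms
    by (auto simp: vector_fields_def vf_diff_def tangent_space_add tangent_space_scale)
      (simp add: tangent_add_def zero_tangent_def tangent_scale_def)
qed

lemma vector_fields_scale:
  assumes "smooth_manifold M" "X \<in> vector_fields M" "f \<in> smooth_functions M"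
  shows "vf_scale f X \<in> vector_fields M"
proof -
  have "act (vf_scale f X) h = (\<lambda>p. f p * act X h p)" for h
    by (simp add: act_def vf_scale_def tangent_scale_def)
  then show ?thesis
    using assms smooth_functions_mult[OF assms(1)]
    by (auto simp: vector_fields_def vf_scale_def tangent_space_scale)
      (simp add: zero_tangent_def tangent_scale_def)
qed

text \<open>Turns vanishing torsion and a vanishing derivative of \<open>J\<close> into equations of
  vector fields, usable for rewriting.\<close>

lemma vf_diff_eq_zero_iff: "vf_diff X Y = (\<lambda>p. zero_tangent) \<longleftrightarrow> X = Y"
  by (auto simp: vf_diff_def tangent_add_def tangent_scale_def zero_tangent_def fun_eq_iff)

lemma vector_field_tangent: "X \<in> vector_fields M \<Longrightarrow> p \<in> pts M \<Longrightarrow> X p \<in> tangent_space M p"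
  by (simp add: vector_fields_def)

lemma act_add:
  assumes "W \<in> vector_fields M" "f \<in> smooth_functions M" "h \<in> smooth_functions M"
  shows "act W (\<lambda>p. f p + h p) p = act W f p + act W h p"
proof (cases "p \<in> pts M")
  case True
  then have "W p (\<lambda>q. 1 * f q + h q) = 1 * W p f + W p h"
    using vector_field_tangent[OF assms(1)] assms(2,3) unfolding tangent_space_def by blast
  then show ?thesis by (simp add: act_def)
next
  case False
  then show ?thesis using assms(1) by (simp add: act_def vector_fields_def zero_tangent_def)
qed

lemma act_mult:
  assumes "W \<in> vector_fields M" "f \<in> smooth_functions M" "h \<in> smooth_functions M"
  shows "act W (\<lambda>p. f p * h p) p = f p * act W h p + act W f p * h p"
proof (cases "p \<in> pts M")
  case True
  then show ?thesis
    using vector_field_tangent[OF assms(1)] assms(2,3) unfolding tangent_space_def act_def by blast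
next
  case False
  then show ?thesis using assms(1) by (simp add: act_def vector_fields_def zero_tangent_def)
qed

section \<open>Pointwise linearity of tensors\<close>

lemma linear_tangent_ops:
  fixes \<phi> :: "'a tangent \<Rightarrow> real"
  assumes lin: "\<And>a u v. u \<in> T \<Longrightarrow> v \<in> T \<Longrightarrow>
      \<phi> (tangent_add (tangent_scale a u) v) = a * \<phi> u + \<phi> v"
  shows "u \<in> T \<Longrightarrow> v \<in> T \<Longrightarrow> \<phi> (tangent_add u v) = \<phi> u + \<phi> v"
    and "u \<in> T \<Longrightarrow> \<phi> (tangent_scale a u) = a * \<phi> u"
    and "u \<in> T \<Longrightarrow> v \<in> T \<Longrightarrow> \<phi> (tangent_add u (tangent_scale (-1) v)) = \<phi> u - \<phi> v"
proof -
  have "tangent_scale 1 u = u"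
    by (simp add: tangent_scale_def)
  then show "u \<in> T \<Longrightarrow> v \<in> T \<Longrightarrow> \<phi> (tangent_add u v) = \<phi> u + \<phi> v"
    using lin[of u v 1] by simp
  \<comment> \<open>Writing \<open>a u\<close> as \<open>(a - 1) u + u\<close> fits the single
    linearity axiom without first computing the value at zero.\<close>
  have "tangent_add (tangent_scale (a - 1) u) u = tangent_scale a u"
    by (simp add: tangent_add_def tangent_scale_def fun_eq_iff algebra_simps)
  then show "u \<in> T \<Longrightarrow> \<phi> (tangent_scale a u) = a * \<phi> u"
    using lin[of u u "a - 1"] by (simp add: algebra_simps)
  have "tangent_add u (tangent_scale (-1) v) = tangent_add (tangent_scale (-1) v) u"
    by (simp add: tangent_add_def fun_eq_iff)
  then show "u \<in> T \<Longrightarrow> v \<in> T \<Longrightarrow> \<phi> (tangent_add u (tangent_scale (-1) v)) = \<phi> u - \<phi> v"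
    using lin[of v u "-1"] by simp
qed

lemma one_form_ops:
  assumes "one_form M \<theta>" "X \<in> vector_fields M"
  shows "Y \<in> vector_fields M \<Longrightarrow> ev1 \<theta> (vf_add X Y) p = ev1 \<theta> X p + ev1 \<theta> Y p"
    and "Y \<in> vector_fields M \<Longrightarrow> ev1 \<theta> (vf_diff X Y) p = ev1 \<theta> X p - ev1 \<theta> Y p"
    and "ev1 \<theta> (vf_scale f X) p = f p * ev1 \<theta> X p"
proof -
  have off: "\<theta> p u = 0" if "p \<notin> pts M" for u
    using assms(1) that by (simp add: one_form_def)
  have lin: "\<theta> p (tangent_add (tangent_scale a u) v) = a * \<theta> p u + \<theta> p v"
    if "p \<in> pts M" "u \<in> tangent_space M p" "v \<in> tangent_space M p" for a u v
    using assms(1) that by (simp add: one_form_def)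
  note ops = linear_tangent_ops[where T = "tangent_space M p" and \<phi> = "\<theta> p", OF lin]
  note tan = vector_field_tangent[where M = M and p = p]
  show "ev1 \<theta> (vf_add X Y) p = ev1 \<theta> X p + ev1 \<theta> Y p" if "Y \<in> vector_fields M"
    using off ops(1) tan[OF assms(2)] tan[OF that]
    by (cases "p \<in> pts M") (simp_all add: ev1_def vf_add_def)
  show "ev1 \<theta> (vf_diff X Y) p = ev1 \<theta> X p - ev1 \<theta> Y p" if "Y \<in> vector_fields M"
    using off ops(3) tan[OF assms(2)] tan[OF that]
    by (cases "p \<in> pts M") (simp_all add: ev1_def vf_diff_def)
  show "ev1 \<theta> (vf_scale f X) p = f p * ev1 \<theta> X p"
    using off ops(2) tan[OF assms(2)]
    by (cases "p \<in> pts M") (simp_all add: ev1_def vf_scale_def)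
qed

lemma one_form_zero:
  assumes "one_form M \<theta>" "X \<in> vector_fields M" "X p = zero_tangent"
  shows "ev1 \<theta> X p = 0"
proof -
  have "X p = vf_scale (\<lambda>_. 0) X p"
    using assms(3) by (simp add: vf_scale_def tangent_scale_def zero_tangent_def)
  then show ?thesis
    using one_form_ops(3)[OF assms(1,2), of "\<lambda>_. 0" p] by (simp add: ev1_def)
qed

lemma metric_sym:
  assumes "riemannian_metric M g" "X \<in> vector_fields M" "Y \<in> vector_fields M"
  shows "ev2 g X Y p = ev2 g Y X p"
  using assms vector_field_tangent[where M = M and p = p]
  by (cases "p \<in> pts M") (auto simp: riemannian_metric_def ev2_def)

lemma metric_ops_left:
  assumes "riemannian_metric M g" "X \<in> vector_fields M" "Z \<in> vector_fields M"
  shows "Y \<in> vector_fields M \<Longrightarrow> ev2 g (vf_add X Y) Z p = ev2 g X Z p + ev2 g Y Z p"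
    and "Y \<in> vector_fields M \<Longrightarrow> ev2 g (vf_diff X Y) Z p = ev2 g X Z p - ev2 g Y Z p"
    and "ev2 g (vf_scale f X) Z p = f p * ev2 g X Z p"
proof -
  have off: "g p u v = 0" if "p \<notin> pts M" for u v
    using assms(1) that by (simp add: riemannian_metric_def)
  note tan = vector_field_tangent[where M = M and p = p]
  have lin: "g p (tangent_add (tangent_scale a u) v) (Z p) = a * g p u (Z p) + g p v (Z p)"
    if "p \<in> pts M" "u \<in> tangent_space M p" "v \<in> tangent_space M p" for a u v
    using assms(1) that tan[OF assms(3)] by (simp add: riemannian_metric_def)
  note ops = linear_tangent_ops[where T = "tangent_space M p" and \<phi> = "\<lambda>u. g p u (Z p)", OF lin]
  show "ev2 g (vf_add X Y) Z p = ev2 g X Z p + ev2 g Y Z p" if "Y \<in> vector_fields M"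
    using off ops(1) tan[OF assms(2)] tan[OF that]
    by (cases "p \<in> pts M") (simp_all add: ev2_def vf_add_def)
  show "ev2 g (vf_diff X Y) Z p = ev2 g X Z p - ev2 g Y Z p" if "Y \<in> vector_fields M"
    using off ops(3) tan[OF assms(2)] tan[OF that]
    by (cases "p \<in> pts M") (simp_all add: ev2_def vf_diff_def)
  show "ev2 g (vf_scale f X) Z p = f p * ev2 g X Z p"
    using off ops(2) tan[OF assms(2)]
    by (cases "p \<in> pts M") (simp_all add: ev2_def vf_scale_def)
qed

lemma metric_diff_right:
  assumes "riemannian_metric M g" "smooth_manifold M"
    "X \<in> vector_fields M" "Y \<in> vector_fields M" "Z \<in> vector_fields M"
  shows "ev2 g X (vf_diff Y Z) p = ev2 g X Y p - ev2 g X Z p"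
  using metric_sym[OF assms(1,3) vector_fields_diff[OF assms(2,4,5)]]
    metric_ops_left(2)[OF assms(1,4,3,5)] metric_sym[OF assms(1,3,4)] metric_sym[OF assms(1,3,5)]
  by simp

lemma metric_definite:
  assumes "riemannian_metric M g" "X \<in> vector_fields M" "ev2 g X X p = 0"
  shows "X p = zero_tangent"
proof (rule ccontr)
  assume nz: "X p \<noteq> zero_tangent"
  then have "p \<in> pts M"
    using assms(2) by (auto simp: vector_fields_def)
  then have "g p (X p) (X p) > 0"
    using assms(1) nz vector_field_tangent[OF assms(2)] unfolding riemannian_metric_def by blast
  then show False
    using assms(3) by (simp add: ev2_def)
qed

section \<open>Hermitian manifolds\<close>

locale hermitian =
  fixes M :: "('a, 'e::euclidean_space) manifold" and J :: "'a endo" and g :: "'a form2"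
  assumes hermitian: "hermitian_manifold M J g"
begin

lemma smooth: "smooth_manifold M"
  and metric: "riemannian_metric M g"
  and acs: "almost_complex_structure M J"
  and integrable: "integrable_acs M J"
  and compatible: "p \<in> pts M \<Longrightarrow> u \<in> tangent_space M p \<Longrightarrow> v \<in> tangent_space M p \<Longrightarrow>
    g p (J p u) (J p v) = g p u v"
  using hermitian by (auto simp: hermitian_manifold_def)

lemma J_closed: "X \<in> vector_fields M \<Longrightarrow> app J X \<in> vector_fields M"
  using acs by (simp add: almost_complex_structure_def)

lemmas closed = J_closed vector_fields_add[OF smooth] vector_fields_diff[OF smooth]
  vector_fields_scale[OF smooth]

lemmas sym = metric_sym[OF metric]
lemmas g_left = metric_ops_left[OF metric]
lemmas g_diff_right = metric_diff_right[OF metric smooth]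

text \<open>\<open>J \<circ> J = -1\<close> is phrased with \<open>vf_scale\<close> so that the
  scaling laws of \<open>g\<close> and \<open>\<theta>\<close> apply; off \<open>M\<close> both
  sides are the zero tangent.\<close>

lemma J_J:
  assumes "X \<in> vector_fields M"
  shows "app J (app J X) = vf_scale (\<lambda>_. -1) X"
proof
  fix p
  show "app J (app J X) p = vf_scale (\<lambda>_. -1) X p"
  proof (cases "p \<in> pts M")
    case True
    then show ?thesis
      using acs vector_field_tangent[OF assms True]
      by (simp add: almost_complex_structure_def app_def vf_scale_def)
  next
    case False
    then show ?thesis
      using acs assms by (simp add: almost_complex_structure_def app_def vf_scale_def
          vector_fields_def zero_tangent_def tangent_scale_def)
  qed
qed

lemma g_J_J:
  assumes "X \<in> vector_fields M" "Y \<in> vector_fields M"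
  shows "ev2 g (app J X) (app J Y) p = ev2 g X Y p"
proof (cases "p \<in> pts M")
  case True
  then show ?thesis
    using compatible[OF True] assms[THEN vector_field_tangent, OF True] by (simp add: ev2_def app_def)
next
  case False
  then show ?thesis
    using metric by (simp add: riemannian_metric_def ev2_def)
qed

lemma g_J_J_left:
  assumes "X \<in> vector_fields M" "Y \<in> vector_fields M"
  shows "ev2 g (app J (app J X)) Y p = - ev2 g X Y p"
  using assms by (simp add: J_J g_left)

text \<open>An isometry with square \<open>-1\<close> is skew-adjoint. As a rewrite rule this moves
  every \<open>J\<close> into the second slot.\<close>

lemma g_J_left:
  assumes "X \<in> vector_fields M" "Y \<in> vector_fields M"
  shows "ev2 g (app J X) Y p = - ev2 g X (app J Y) p"
proof -
  have "ev2 g X (app J Y) p = ev2 g (app J X) (app J (app J Y)) p"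
    using assms by (simp add: g_J_J J_closed)
  also have "\<dots> = ev2 g (app J (app J Y)) (app J X) p"
    using assms by (intro sym closed)
  also have "\<dots> = - ev2 g Y (app J X) p"
    using assms by (simp add: g_J_J_left J_closed)
  also have "\<dots> = - ev2 g (app J X) Y p"
    using assms sym[of Y "app J X" p] by (simp add: J_closed)
  finally show ?thesis by simp
qed

lemma fundamental_form_eq: "ev2 (fundamental_form J g) X Y = ev2 g (app J X) Y"
  by (simp add: ev2_def fundamental_form_def app_def)

lemma g_smooth: "X \<in> vector_fields M \<Longrightarrow> Y \<in> vector_fields M \<Longrightarrow> ev2 g X Y \<in> smooth_functions M"
  using metric by (simp add: riemannian_metric_def)

end

section \<open>The Bismut torsion of an LCK manifold\<close>

text \<open>The LCK setting; parallelism of \<open>\<theta>\<close> enters only in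
  \<open>torsion_form_parallel\<close>.\<close>

locale lck_bismut = hermitian +
  fixes \<theta> :: "'a form1" and D B :: "'a connection"
  assumes lee: "lee_form M J g \<theta>"
    and levi_civita: "levi_civita M g D"
    and bismut: "bismut_connection M J g B"
begin

abbreviation "c \<equiv> torsion_form g B"

section \<open>Closure of vector fields under the connections, the bracket and the torsion\<close>

lemma D_closed: "X \<in> vector_fields M \<Longrightarrow> Y \<in> vector_fields M \<Longrightarrow> D X Y \<in> vector_fields M"
  using levi_civita unfolding levi_civita_def affine_connection_def by blast

lemma B_closed: "X \<in> vector_fields M \<Longrightarrow> Y \<in> vector_fields M \<Longrightarrow> B X Y \<in> vector_fields M"
  using bismut unfolding bismut_connection_def affine_connection_def by blast

text \<open>\<open>D\<close> is torsion-free, so closure under brackets reduces to closure under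
  \<open>D\<close>.\<close>

lemma bracket_eq:
  "X \<in> vector_fields M \<Longrightarrow> Y \<in> vector_fields M \<Longrightarrow> lie_bracket X Y = vf_diff (D X Y) (D Y X)"
  using levi_civita unfolding levi_civita_def torsion_def vf_diff_eq_zero_iff by metis

lemma bracket_closed:
  "X \<in> vector_fields M \<Longrightarrow> Y \<in> vector_fields M \<Longrightarrow> lie_bracket X Y \<in> vector_fields M"
  by (simp add: bracket_eq closed D_closed)

lemma torsion_closed:
  "X \<in> vector_fields M \<Longrightarrow> Y \<in> vector_fields M \<Longrightarrow> torsion B X Y \<in> vector_fields M"
  by (simp add: torsion_def closed B_closed bracket_closed)

lemmas in_fields = closed D_closed B_closed bracket_closed torsion_closed

lemma B_J:
  "X \<in> vector_fields M \<Longrightarrow> Y \<in> vector_fields M \<Longrightarrow> B X (app J Y) = app J (B X Y)"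
  using bismut
  unfolding bismut_connection_def parallel_endo_def cov_deriv_endo_def vf_diff_eq_zero_iff by blast

section \<open>Symmetries of the torsion form\<close>

lemma torsion_form_skew:
  assumes "X \<in> vector_fields M" "Y \<in> vector_fields M" "Z \<in> vector_fields M"
  shows "c Y X Z p = - c X Y Z p" "c X Z Y p = - c X Y Z p"
proof -
  have "c X Y Z p = - c Y X Z p \<and> c X Y Z p = - c X Z Y p"
    using bismut assms unfolding bismut_connection_def by blast
  then show "c Y X Z p = - c X Y Z p" "c X Z Y p = - c X Y Z p"
    by simp_all
qed

lemma torsion_form_cyclic:
  assumes "X \<in> vector_fields M" "Y \<in> vector_fields M" "Z \<in> vector_fields M"
  shows "c Z X Y p = c X Y Z p"
  using torsion_form_skew[OF assms, of p] torsion_form_skew[OF assms(1,3,2), of p] by linarith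

lemma torsion_form_J_J:
  assumes "X \<in> vector_fields M" "Y \<in> vector_fields M" "Z \<in> vector_fields M"
  shows "c (app J (app J X)) Y Z p = - c X Y Z p"
  using assms by (simp add: torsion_form_def g_J_J_left in_fields)

section \<open>Brackets, the difference of the connections and \<open>d \<omega>\<close> in terms of
  the torsion\<close>

lemma g_bracket_B:
  assumes "X \<in> vector_fields M" "Y \<in> vector_fields M" "Z \<in> vector_fields M"
  shows "ev2 g (lie_bracket X Y) Z p = ev2 g (B X Y) Z p - ev2 g (B Y X) Z p - c X Y Z p"
proof -
  have "c Z X Y p = ev2 g (torsion B X Y) Z p"
    unfolding torsion_form_def using assms by (intro sym in_fields)
  also have "\<dots> = ev2 g (B X Y) Z p - ev2 g (B Y X) Z p - ev2 g (lie_bracket X Y) Z p"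
    using assms by (simp add: torsion_def g_left in_fields)
  finally show ?thesis
    using torsion_form_cyclic[OF assms, of p] by simp
qed

lemma g_bracket_D:
  assumes "X \<in> vector_fields M" "Y \<in> vector_fields M" "Z \<in> vector_fields M"
  shows "ev2 g (lie_bracket X Y) Z p = ev2 g (D X Y) Z p - ev2 g (D Y X) Z p"
  using assms by (simp add: bracket_eq g_left in_fields)

lemma act_g_B:
  assumes "X \<in> vector_fields M" "Y \<in> vector_fields M" "Z \<in> vector_fields M"
  shows "act X (ev2 g Y Z) p = ev2 g (B X Y) Z p + ev2 g (B X Z) Y p"
proof -
  have "cov_deriv2 B g X Y Z = (\<lambda>p. 0)"
    using bismut assms by (simp add: bismut_connection_def parallel2_def)
  from fun_cong[OF this, of p] show ?thesis
    using assms by (simp add: cov_deriv2_def sym[of Y "B X Z"] in_fields)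
qed

lemma act_g_D:
  assumes "X \<in> vector_fields M" "Y \<in> vector_fields M" "Z \<in> vector_fields M"
  shows "act X (ev2 g Y Z) p = ev2 g (D X Y) Z p + ev2 g (D X Z) Y p"
proof -
  have "cov_deriv2 D g X Y Z = (\<lambda>p. 0)"
    using levi_civita assms by (simp add: levi_civita_def parallel2_def)
  from fun_cong[OF this, of p] show ?thesis
    using assms by (simp add: cov_deriv2_def sym[of Y "D X Z"] in_fields)
qed

text \<open>A Koszul argument: the difference of two metric connections is skew in the last two
  slots, and its antisymmetrization in the first two is the difference of the torsions, here
  \<open>c\<close>.\<close>

lemma bismut_minus_levi_civita:
  assumes XYZ: "X \<in> vector_fields M" "Y \<in> vector_fields M" "Z \<in> vector_fields M"
  shows "2 * (ev2 g (B X Y) Z p - ev2 g (D X Y) Z p) = c X Y Z p"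
proof -
  define a where "a X Y Z = ev2 g (B X Y) Z p - ev2 g (D X Y) Z p" for X Y Z
  have skew: "a X Z Y = - a X Y Z"
    if "X \<in> vector_fields M" "Y \<in> vector_fields M" "Z \<in> vector_fields M" for X Y Z
    using act_g_B[OF that, of p] act_g_D[OF that, of p] by (simp add: a_def)
  have tor: "c X Y Z p = a X Y Z - a Y X Z"
    if "X \<in> vector_fields M" "Y \<in> vector_fields M" "Z \<in> vector_fields M" for X Y Z
    using g_bracket_B[OF that, of p] g_bracket_D[OF that, of p] by (simp add: a_def)
  \<comment> \<open>By \<open>skew\<close>, the three instances of \<open>tor\<close> express the
    same number \<open>c X Y Z p\<close> as sums of two cyclic shifts of \<open>a X Y Z\<close>;
    first plus third minus second isolates \<open>2 * a X Y Z\<close>.\<close>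
  have "2 * a X Y Z = c X Y Z p"
    using tor[OF XYZ(1,2,3)] tor[OF XYZ(2,3,1)] tor[OF XYZ(3,1,2)]
      skew[OF XYZ(1,2,3)] skew[OF XYZ(2,3,1)] skew[OF XYZ(3,1,2)]
      torsion_form_cyclic[OF XYZ(1,2,3), of p] torsion_form_cyclic[OF XYZ(2,3,1), of p]
    by linarith
  then show ?thesis by (simp add: a_def)
qed

text \<open>\<open>B\<close> preserves \<open>g\<close> and commutes with \<open>J\<close>, so its
  terms from the derivatives and from the brackets cancel; only the torsion in the brackets
  survives.\<close>

lemma ext_deriv2_fundamental_form:
  assumes XYZ: "X \<in> vector_fields M" "Y \<in> vector_fields M" "Z \<in> vector_fields M"
  shows "ext_deriv2 (fundamental_form J g) X Y Z p
      = - (c (app J X) Y Z p + c X (app J Y) Z p + c X Y (app J Z) p)"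
proof -
  have act: "act X (ev2 g (app J Y) Z) p = ev2 g (B X Z) (app J Y) p - ev2 g (B X Y) (app J Z) p"
    if "X \<in> vector_fields M" "Y \<in> vector_fields M" "Z \<in> vector_fields M" for X Y Z
    using that by (simp add: act_g_B B_J g_J_left in_fields)
  have br: "ev2 g (app J (lie_bracket X Y)) Z p
      = ev2 g (B Y X) (app J Z) p - ev2 g (B X Y) (app J Z) p + c X Y (app J Z) p"
    if "X \<in> vector_fields M" "Y \<in> vector_fields M" "Z \<in> vector_fields M" for X Y Z
    using that by (simp add: g_J_left g_bracket_B in_fields)
  have "c Y Z (app J X) p = c (app J X) Y Z p" "c X Z (app J Y) p = - c X (app J Y) Z p"
    using XYZ torsion_form_cyclic[of Y Z "app J X" p] torsion_form_skew(2)[of X "app J Y" Z p]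
    by (simp_all add: in_fields)
  then show ?thesis
    using XYZ by (simp add: ext_deriv2_def fundamental_form_eq act br)
qed

text \<open>This is \<open>N = 0\<close> paired with \<open>Z\<close>: the \<open>B\<close> terms
  cancel again. It says that \<open>c\<close> has no part of type (3,0)+(0,3).\<close>

lemma torsion_form_type:
  assumes XYZ: "X \<in> vector_fields M" "Y \<in> vector_fields M" "Z \<in> vector_fields M"
  shows "c X Y Z p
    = c X (app J Y) (app J Z) p + c (app J X) Y (app J Z) p + c (app J X) (app J Y) Z p"
proof -
  have "ev2 g (nijenhuis J X Y) Z p = 0"
  proof -
    have "nijenhuis J X Y = vf_scale (\<lambda>_. 0) X"
      using integrable XYZ
      by (simp add: integrable_acs_def vf_scale_def tangent_scale_def zero_tangent_def)
    then show ?thesis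
      using XYZ by (simp add: g_left)
  qed
  then have "ev2 g (lie_bracket (app J X) (app J Y)) Z p - ev2 g (lie_bracket X Y) Z p
      + ev2 g (lie_bracket (app J X) Y) (app J Z) p + ev2 g (lie_bracket X (app J Y)) (app J Z) p = 0"
    using XYZ by (simp add: nijenhuis_def g_left g_J_left in_fields)
  then show ?thesis
    \<comment> \<open>Pairs of \<open>J\<close> are removed by \<open>g_J_J\<close> first; only then
      are the remaining single ones moved to the right.\<close>
    using XYZ by (simp add: g_bracket_B B_J g_J_J in_fields)
      (simp add: g_J_left in_fields)
qed

text \<open>Inserting \<open>JX, JY, JZ\<close> into the formula for \<open>d \<omega>\<close>
  produces the right side of \<open>torsion_form_type\<close>, so
  \<open>c(X,Y,Z) = d \<omega>(JX,JY,JZ)\<close>. The LCK equation and the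
  \<open>J\<close>-invariance of \<open>\<omega>\<close> finish.\<close>

lemma torsion_form_wedge:
  assumes XYZ: "X \<in> vector_fields M" "Y \<in> vector_fields M" "Z \<in> vector_fields M"
  shows "c X Y Z p = ev1 \<theta> (app J X) p * ev2 g (app J Y) Z p
    + ev1 \<theta> (app J Y) p * ev2 g (app J Z) X p + ev1 \<theta> (app J Z) p * ev2 g (app J X) Y p"
proof -
  note JXYZ = XYZ[THEN J_closed]
  \<comment> \<open>\<open>torsion_form_J_J\<close> acts on the first slot only, so skewness brings
    the second slot to the front and back.\<close>
  have "c (app J X) (app J (app J Y)) (app J Z) p = - c (app J X) Y (app J Z) p"
    using torsion_form_skew(1)[OF J_closed[OF JXYZ(2)] JXYZ(1,3), of p]
      torsion_form_skew(1)[OF XYZ(2) JXYZ(1,3), of p]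
      torsion_form_J_J[OF XYZ(2) JXYZ(1,3), of p] by simp
  moreover have "c (app J X) (app J Y) (app J (app J Z)) p = - c (app J X) (app J Y) Z p"
    using torsion_form_cyclic[OF JXYZ(1,2) J_closed[OF JXYZ(3)], of p]
      torsion_form_cyclic[OF JXYZ(1,2) XYZ(3), of p]
      torsion_form_J_J[OF XYZ(3) JXYZ(1,2), of p] by simp
  ultimately have "ext_deriv2 (fundamental_form J g) (app J X) (app J Y) (app J Z) p = c X Y Z p"
    using torsion_form_J_J[OF XYZ(1) JXYZ(2,3), of p] torsion_form_type[OF XYZ, of p]
    by (simp add: ext_deriv2_fundamental_form JXYZ)
  moreover have "ext_deriv2 (fundamental_form J g) (app J X) (app J Y) (app J Z)
      = wedge12 \<theta> (fundamental_form J g) (app J X) (app J Y) (app J Z)"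
    using lee JXYZ by (simp add: lee_form_def)
  ultimately show ?thesis
    using XYZ JXYZ by (simp add: wedge12_def fundamental_form_eq g_J_J_left)
      (simp add: g_J_left)
qed

section \<open>The Lee form under the two connections, and parallel torsion\<close>

lemma one_form: "one_form M \<theta>"
  using lee by (simp add: lee_form_def)

lemmas \<theta>_ops = one_form_ops[OF one_form]

lemma \<theta>_smooth: "X \<in> vector_fields M \<Longrightarrow> ev1 \<theta> X \<in> smooth_functions M"
  using one_form by (simp add: one_form_def)

text \<open>Transfers parallelism of \<open>\<theta>\<close> from \<open>D\<close> to
  \<open>B\<close>. The argument runs at a single point \<open>p\<close>, where
  \<open>\<omega>(W,X)\<close> is zero or invertible.\<close>

lemma Lee_form_bismut_eq_levi_civita:
  assumes WX: "W \<in> vector_fields M" "X \<in> vector_fields M"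
  shows "ev1 \<theta> (B W X) p = ev1 \<theta> (D W X) p"
proof -
  define E where "E = vf_diff (B W X) (D W X)"
  \<comment> \<open>The doubling is \<open>vf_add E E\<close> because a constant function need not
    vanish off \<open>M\<close>, hence need not lie in \<open>smooth_functions M\<close>, as
    \<open>vector_fields_scale\<close> requires.\<close>
  define V where "V = vf_diff (vf_add (vf_add E E) (vf_scale (ev1 \<theta> (app J X)) (app J W)))
    (vf_scale (ev1 \<theta> (app J W)) (app J X))"
  note V_fields = in_fields WX \<theta>_smooth
  have E: "E \<in> vector_fields M" and V: "V \<in> vector_fields M"
    by (simp_all add: E_def V_def V_fields)
  \<comment> \<open>The two corrections cancel the terms of \<open>c(W,X,Z)\<close> containing
    \<open>\<alpha>(W)\<close> and \<open>\<alpha>(X)\<close>.\<close>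
  have gV: "ev2 g V Z p = ev2 g (app J W) X p * ev1 \<theta> (app J Z) p"
    if Z: "Z \<in> vector_fields M" for Z
  proof -
    have "2 * ev2 g E Z p = c W X Z p"
      using bismut_minus_levi_civita[OF WX Z, of p] Z by (simp add: E_def g_left V_fields)
    moreover have "ev2 g (app J Z) W p = - ev2 g (app J W) Z p"
      using g_J_left[OF Z WX(1)] sym[OF Z J_closed[OF WX(1)]] by simp
    ultimately show ?thesis
      using torsion_form_wedge[OF WX Z, of p] Z E
      by (simp add: V_def g_left V_fields)
  qed
  have "ev1 \<theta> V p = 0"
  \<comment> \<open>If the factor vanishes, \<open>Z = V\<close> gives \<open>g(V,V) = 0\<close>, so
    \<open>V\<close> is zero at \<open>p\<close>. Otherwise \<open>Z = JV\<close> applies: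
    \<open>g(V,JV) = 0\<close> by skewness of \<open>J\<close>, and dividing leaves
    \<open>\<theta>(JJV) = -\<theta>(V) = 0\<close>.\<close>
  proof (cases "ev2 g (app J W) X p = 0")
    case True
    then show ?thesis
      using gV[OF V] metric_definite[OF metric V] one_form_zero[OF one_form V] by simp
  next
    case False
    have "ev2 g V (app J V) p = 0"
      using g_J_left[OF V V, of p] sym[OF V J_closed[OF V], of p] by simp
    then have "ev1 \<theta> (app J (app J V)) p = 0"
      using gV[OF J_closed[OF V]] False by simp
    then show ?thesis
      using V by (simp add: J_J \<theta>_ops)
  qed
  \<comment> \<open>The corrections contribute
    \<open>\<alpha>(X) \<alpha>(W) - \<alpha>(W) \<alpha>(X) = 0\<close>.\<close>
  moreover have "ev1 \<theta> V p = 2 * ev1 \<theta> E p"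
    using E by (simp add: V_def \<theta>_ops V_fields)
  ultimately show ?thesis
    by (simp add: E_def \<theta>_ops V_fields)
qed

lemma torsion_form_parallel:
  assumes "parallel1 M D \<theta>"
  shows "parallel3 M B c"
proof -
  have act_\<theta>: "act W (ev1 \<theta> (app J X)) p = ev1 \<theta> (app J (B W X)) p"
    if "W \<in> vector_fields M" "X \<in> vector_fields M" for W X p
  proof -
    have "cov_deriv1 D \<theta> W (app J X) = (\<lambda>p. 0)"
      using assms that by (simp add: parallel1_def in_fields)
    from fun_cong[OF this, of p] show ?thesis
      using that by (simp add: cov_deriv1_def Lee_form_bismut_eq_levi_civita[symmetric] B_J in_fields)
  qed
  have act_\<omega>: "act W (ev2 g (app J X) Y) p
      = ev2 g (app J (B W X)) Y p + ev2 g (app J X) (B W Y) p"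
    if "W \<in> vector_fields M" "X \<in> vector_fields M" "Y \<in> vector_fields M" for W X Y p
    using that by (simp add: act_g_B B_J in_fields sym[of "B W Y" "app J X"])
  have "cov_deriv3 B c W X Y Z p = 0"
    if W: "W \<in> vector_fields M"
      and XYZ: "X \<in> vector_fields M" "Y \<in> vector_fields M" "Z \<in> vector_fields M" for W X Y Z p
  proof -
    note smooth_fields = W XYZ in_fields \<theta>_smooth g_smooth
      smooth_functions_mult[OF smooth] smooth_functions_add[OF smooth]
    \<comment> \<open>An equality of functions, since \<open>act W\<close> differentiates and a
      value at \<open>p\<close> alone would not suffice.\<close>
    have "c X Y Z = (\<lambda>p. ev1 \<theta> (app J X) p * ev2 g (app J Y) Z p
        + ev1 \<theta> (app J Y) p * ev2 g (app J Z) X p + ev1 \<theta> (app J Z) p * ev2 g (app J X) Y p)"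
      using torsion_form_wedge[OF XYZ] by (intro ext)
    then have "act W (c X Y Z) p
      = ev1 \<theta> (app J X) p * act W (ev2 g (app J Y) Z) p
        + act W (ev1 \<theta> (app J X)) p * ev2 g (app J Y) Z p
        + (ev1 \<theta> (app J Y) p * act W (ev2 g (app J Z) X) p
        + act W (ev1 \<theta> (app J Y)) p * ev2 g (app J Z) X p)
        + (ev1 \<theta> (app J Z) p * act W (ev2 g (app J X) Y) p
        + act W (ev1 \<theta> (app J Z)) p * ev2 g (app J X) Y p)"
      by (simp add: act_add[where M = M] act_mult[where M = M] smooth_fields)
    \<comment> \<open>Each Leibniz term has \<open>B W\<close> inside one argument; together they
      are the wedge formula for the three terms subtracted in \<open>cov_deriv3\<close>.\<close>
    then show ?thesis
      by (simp add: cov_deriv3_def torsion_form_wedge act_\<theta> act_\<omega> smooth_fields algebra_simps)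
  qed
  then show ?thesis
    by (simp add: parallel3_def fun_eq_iff)
qed

end

theorem corollary3p9:
  fixes M :: "('a, 'e::euclidean_space) manifold"
    and J :: "'a endo" and g :: "'a form2" and Db :: "'a connection" and n :: nat
  assumes "DIM('e) = 2 * n" and "n \<ge> 2"
    and "vaisman_manifold M J g"
    and "bismut_connection M J g Db"
  shows "parallel3 M Db (torsion_form g Db)"
proof -
  obtain \<theta> D where h: "hermitian_manifold M J g" "lee_form M J g \<theta>" "levi_civita M g D"
    and par: "parallel1 M D \<theta>"
    using assms(3) unfolding vaisman_manifold_def by blast
  interpret lck_bismut M J g \<theta> D Db
    using h assms(4) by unfold_locales
  show ?thesis
    using par by (rule torsion_form_parallel)
qed

end
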